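(* Let $n\ge 2$ and let $(L,[,\ldots,],\alpha)$ be a multiplicative $n$-ary Hom-Nambu-Lie algebra over $\mathbf{k}$. Then $L$ is also a multiplicative $n$-ary Hom-Maltsev algebra.
   Context: $\mathbf{k}$ is a fixed field of characteristic $0$. For $n\ge 2$, an $n$-ary Hom-algebra $(A,[,\ldots,],\alpha=(\alpha_1,\ldots,\alpha_{n-1}))$ is a $\mathbf{k}$-module $A$ with an $n$-linear map $[,\ldots,]\colon A^{\otimes n}\to A$ and linear maps $\alpha_i\colon A\to A$ (the twisting maps). It is multiplicative if all the twisting maps are equal to one map $\alpha$ and $\alpha([x_1,\ldots,x_n])=[\alpha(x_1),\ldots,\alpha(x_n)]$; it is then written $(A,[,\ldots,],\alpha)$. The product is anti-symmetric if $[x_1,\ldots,x_n]=\epsilon(\sigma)[x_{\sigma(1)},\ldots,x_{\sigma(n)}]$ for all permutations $\sigma$, with $\epsilon(\sigma)$ the sign. Abbreviations: $x_{i,j}$ stands for the sequence $x_i,\ldots,x_j$; $\alpha_{k,l}(x_{i,j})$ (with $l-k=j-i$) for $\alpha_k(x_i),\alpha_{k+1}(x_{i+1}),\ldots,\alpha_l(x_j)$; $\alpha^2_{k,l}(x_{i,j})$ for $\alpha_k^2(x_i),\ldots,\alpha_l^2(x_j)$; all are empty if $i>j$. An $n$-ary Hom-Nambu-Lie algebra is an $n$-ary Hom-algebra whose product is anti-symmetric and such that for all $x_1,\ldots,x_{n-1},y_1,\ldots,y_n$, $$[\alpha_{1,n-1}(x_{1,n-1}),[y_{1,n}]] = \sum_{i=1}^n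 [\alpha_{1,i-1}(y_{1,i-1}),[x_{1,n-1},y_i],\alpha_{i,n-1}(y_{i+1,n})].$$ The $n$-ary Hom-Maltsevian of $A$ is $$\begin{aligned} M^n_A(z;x_{2,n};y_{2,n}) &= \sum_{i=2}^n \alpha_1\big([[z,x_{2,n}],\alpha_{2,i-1}(x_{2,i-1}),[x_i,y_{2,n}],\alpha_{i,n-1}(x_{i+1,n})]\big)\\ &\quad+ \sum_{i=2}^n [[\alpha_1(z),\alpha_{2,i-1}(x_{2,i-1}),[x_i,y_{2,n}],\alpha_{i,n-1}(x_{i+1,n})],\alpha^2_{1,n-1}(x_{2,n})]\\ &\quad- [[[z,x_{2,n}],\alpha_{1,n-1}(x_{2,n})],\alpha^2_{1,n-1}(y_{2,n})] + [[[z,y_{2,n}],\alpha_{1,n-1}(x_{2,n})],\alpha^2_{1,n-1}(x_{2,n})]. \end{aligned}$$ An $n$-ary Hom-Maltsev algebra is an $n$-ary Hom-algebra $A$ whose product is anti-symmetric and for which $M^n_A(z;x_{2,n};y_{2,n})=0$ for all $z,x_j,y_k\in A$. *)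

theory Defs
  imports Complex_Main "HOL-Combinatorics.Permutations"
begin

text \<open>
  An \<open>n\<close>-ary product is a function on lists, of which only the values on lists of length \<open>n\<close>
  matter.  Sequences \<open>x\<^sub>1, x\<^sub>2, \<dots>\<close> are functions on \<open>nat\<close>, indexed from 1 as on paper.  The twisting
  maps form a family of which only the members \<open>\<alpha> 1, \<dots>, \<alpha> (n - 1)\<close> matter.
\<close>

text \<open>\<open>seg x i j\<close> is \<open>x\<^sub>i, \<dots>, x\<^sub>j\<close>; it is empty if \<open>i > j\<close>.\<close>

definition seg :: "(nat \<Rightarrow> 'a) \<Rightarrow> nat \<Rightarrow> nat \<Rightarrow> 'a list"
  where "seg x i j = map x [i..<Suc j]"

text \<open>
  \<open>tw \<alpha> k [a, b, c, \<dots>]\<close> is \<open>[\<alpha> k a, \<alpha> (k + 1) b, \<alpha> (k + 2) c, \<dots>]\<close>.  Thus the sequence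
  \<open>\<alpha>\<^sub>k(x\<^sub>i), \<dots>, \<alpha>\<^sub>l(x\<^sub>j)\<close> with \<open>l - k = j - i\<close> is \<open>tw \<alpha> k (seg x i j)\<close>; the last index \<open>l\<close> is
  determined by the length.
\<close>

definition tw :: "(nat \<Rightarrow> 'a \<Rightarrow> 'a) \<Rightarrow> nat \<Rightarrow> 'a list \<Rightarrow> 'a list"
  where "tw \<alpha> k xs = map (\<lambda>t. \<alpha> (k + t) (xs ! t)) [0..<length xs]"

definition tw2 :: "(nat \<Rightarrow> 'a \<Rightarrow> 'a) \<Rightarrow> nat \<Rightarrow> 'a list \<Rightarrow> 'a list"
  where "tw2 \<alpha> = tw (\<lambda>i. \<alpha> i \<circ> \<alpha> i)"

locale nary_hom_algebra = vector_space scale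
  for scale :: "'k::field_char_0 \<Rightarrow> 'a::ab_group_add \<Rightarrow> 'a" +
  fixes n :: nat
    and br :: "'a list \<Rightarrow> 'a"
    and \<alpha> :: "nat \<Rightarrow> 'a \<Rightarrow> 'a"
  assumes arity: "n \<ge> 2"
    and multilinear: "\<And>x i. i \<in> {1..n} \<Longrightarrow>
      Vector_Spaces.linear scale scale (\<lambda>a. br (seg (x(i := a)) 1 n))"
    and twist_linear: "\<And>i. i \<in> {1..n-1} \<Longrightarrow> Vector_Spaces.linear scale scale (\<alpha> i)"

locale antisym_nary_hom_algebra = nary_hom_algebra +
  assumes antisym: "\<And>x \<sigma>. \<sigma> permutes {1..n} \<Longrightarrow>
      br (seg x 1 n) = scale (of_int (sign \<sigma>)) (br (seg (x \<circ> \<sigma>) 1 n))"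

definition multiplicative :: "nat \<Rightarrow> ('a list \<Rightarrow> 'a) \<Rightarrow> (nat \<Rightarrow> 'a \<Rightarrow> 'a) \<Rightarrow> bool"
  where "multiplicative n br \<alpha> \<longleftrightarrow>
    (\<exists>a. (\<forall>i\<in>{1..n-1}. \<alpha> i = a) \<and> (\<forall>x. a (br (seg x 1 n)) = br (seg (a \<circ> x) 1 n)))"

locale hom_nambu_lie_algebra = antisym_nary_hom_algebra +
  assumes hom_nambu: "\<And>x y.
      br (tw \<alpha> 1 (seg x 1 (n-1)) @ [br (seg y 1 n)]) =
      (\<Sum>i=1..n. br (tw \<alpha> 1 (seg y 1 (i-1)) @ [br (seg x 1 (n-1) @ [y i])]
                      @ tw \<alpha> i (seg y (i+1) n)))"

text \<open>Only the entries of \<open>x\<close> and \<open>y\<close> with index in \<open>{2..n}\<close> are used.\<close>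

definition hom_maltsevian ::
    "nat \<Rightarrow> ('a::ab_group_add list \<Rightarrow> 'a) \<Rightarrow> (nat \<Rightarrow> 'a \<Rightarrow> 'a) \<Rightarrow> 'a \<Rightarrow> (nat \<Rightarrow> 'a) \<Rightarrow> (nat \<Rightarrow> 'a) \<Rightarrow> 'a"
  where "hom_maltsevian n br \<alpha> z x y =
    (\<Sum>i=2..n. \<alpha> 1 (br ([br (z # seg x 2 n)] @ tw \<alpha> 2 (seg x 2 (i-1))
                        @ [br (x i # seg y 2 n)] @ tw \<alpha> i (seg x (i+1) n))))
  + (\<Sum>i=2..n. br ([br ([\<alpha> 1 z] @ tw \<alpha> 2 (seg x 2 (i-1))
                        @ [br (x i # seg y 2 n)] @ tw \<alpha> i (seg x (i+1) n))]
                   @ tw2 \<alpha> 1 (seg x 2 n)))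
  - br ([br ([br (z # seg x 2 n)] @ tw \<alpha> 1 (seg x 2 n))] @ tw2 \<alpha> 1 (seg y 2 n))
  + br ([br ([br (z # seg y 2 n)] @ tw \<alpha> 1 (seg x 2 n))] @ tw2 \<alpha> 1 (seg x 2 n))"

locale hom_maltsev_algebra = antisym_nary_hom_algebra +
  assumes hom_maltsev: "\<And>z x y. hom_maltsevian n br \<alpha> z x y = 0"

end

theory Submission imports Defs begin

text \<open>
  Write \<open>R\<^sub>x\<close> for the right multiplication \<open>z \<mapsto> [z, x\<^sub>2, \<dots>, x\<^sub>n]\<close> and \<open>a\<close> for the common twisting
  map.  Moving the distinguished argument from the last place to the first one multiplies both sides
  of the Hom-Nambu identity by the sign of the same cycle, so the identity also holds for right
  multiplications.  Expanding the left-hand side along \<open>z\<close> and the \<open>x\<^sub>i\<close>, it reads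
  \<open>[[z, x], a y] = [[z, y], a x] + D (z, x, y)\<close>, where
  \<open>D (z, x, y) = \<Sum>\<^sub>i [a z, \<dots>, [x\<^sub>i, y], \<dots>]\<close> (lemma \<open>right_nambu_head\<close>).

  In the Maltsevian, the second and the fourth summand are \<open>R\<close> by \<open>a\<^sup>2 x\<close> of
  \<open>D (z, x, y) + [[z, y], a x]\<close>, hence together \<open>[[[z, x], a y], a\<^sup>2 x]\<close>.  By multiplicativity the first
  summand is \<open>D ([z, x], a x, a y)\<close>, which by the same identity, now for \<open>[z, x]\<close>, \<open>a x\<close> and \<open>a y\<close>,
  is \<open>[[[z, x], a x], a\<^sup>2 y] - [[[z, x], a y], a\<^sup>2 x]\<close>.  With the third summand everything cancels.
\<close>

section \<open>Sequences and lists\<close>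

lemma length_seg [simp]: "length (seg x i j) = Suc j - i"
  by (simp add: seg_def del: upt_Suc)

lemma seg_nth: "k < Suc j - i \<Longrightarrow> seg x i j ! k = x (i + k)"
  by (simp add: seg_def del: upt_Suc)

lemma seg_of_list: "seg (\<lambda>k. ys ! (k - 1)) 1 (length ys) = ys"
  by (rule nth_equalityI) (auto simp: seg_nth)

lemma map_seg: "map f (seg x i j) = seg (f \<circ> x) i j"
  by (simp add: seg_def)

lemma seg_take: "k \<le> Suc j - i \<Longrightarrow> 0 < i + k \<Longrightarrow> take k (seg x i j) = seg x i (i + k - 1)"
  by (rule nth_equalityI) (auto simp: seg_nth)

lemma seg_drop: "drop k (seg x i j) = seg x (i + k) j"
  by (rule nth_equalityI) (auto simp: seg_nth add.assoc)

lemma tw_const: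
  assumes "\<And>t. t < length xs \<Longrightarrow> \<alpha> (k + t) = a"
  shows "tw \<alpha> k xs = map a xs"
  by (rule nth_equalityI) (auto simp: tw_def assms)

lemma tw2_const:
  assumes "\<And>t. t < length xs \<Longrightarrow> \<alpha> (k + t) = a"
  shows "tw2 \<alpha> k xs = map a (map a xs)"
  unfolding tw2_def by (rule nth_equalityI) (auto simp: tw_def assms)

section \<open>Multilinearity and cyclic shifts on lists\<close>

lemma (in nary_hom_algebra) linear_slot:
  assumes "length us + length ws + 1 = n"
  shows "Vector_Spaces.linear scale scale (\<lambda>v. br (us @ [v] @ ws))"
proof -
  define x where "x = (\<lambda>k. (us @ [0] @ ws) ! (k - 1))"
  have "seg (x(Suc (length us) := v)) 1 n = us @ [v] @ ws" for v
  proof (rule nth_equalityI)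
    show "length (seg (x(Suc (length us) := v)) 1 n) = length (us @ [v] @ ws)"
      using assms by simp
  qed (use assms in \<open>auto simp: seg_nth x_def nth_append nth_Cons'\<close>)
  then show ?thesis
    using multilinear[of "Suc (length us)" x] assms by simp
qed

lemma (in nary_hom_algebra)
  assumes "length us + length ws + 1 = n"
  shows br_slot_scale: "br (us @ [scale c v] @ ws) = scale c (br (us @ [v] @ ws))"
    and br_slot_add: "br (us @ [v + w] @ ws) = br (us @ [v] @ ws) + br (us @ [w] @ ws)"
    and br_slot_sum: "br (us @ [\<Sum>i\<in>I. f i] @ ws) = (\<Sum>i\<in>I. br (us @ [f i] @ ws))"
proof -
  interpret L: Vector_Spaces.linear scale scale "\<lambda>v. br (us @ [v] @ ws)"
    by (rule linear_slot) fact
  show "br (us @ [scale c v] @ ws) = scale c (br (us @ [v] @ ws))" by (rule L.scale)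
  show "br (us @ [v + w] @ ws) = br (us @ [v] @ ws) + br (us @ [w] @ ws)" by (rule L.add)
  show "br (us @ [\<Sum>i\<in>I. f i] @ ws) = (\<Sum>i\<in>I. br (us @ [f i] @ ws))" by (rule L.sum)
qed

lemma cyclic_shift_permutes:
  fixes n :: nat
  assumes "1 \<le> n"
  shows "(\<lambda>k. if k \<in> {1..<n} then k + 1 else if k = n then 1 else k) permutes {1..n}"
    (is "?\<sigma> permutes _")
proof (rule bij_imp_permutes)
  have inj: "inj_on ?\<sigma> {1..n}"
    by (auto simp: inj_on_def split: if_splits)
  have "?\<sigma> ` {1..n} \<subseteq> {1..n}"
    using assms by auto
  then show "bij_betw ?\<sigma> {1..n} {1..n}"
    using inj endo_inj_surj[of "{1..n}" ?\<sigma>] by (simp add: bij_betw_def)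
qed (use assms in auto)

text \<open>
  The scalar is the sign of an \<open>n\<close>-cycle.  It is chosen once for all arguments, so that it cancels
  when both sides of an identity between brackets are shifted.
\<close>

lemma (in antisym_nary_hom_algebra) br_cyclic_shift:
  obtains s where "\<And>v xs. length xs = n - 1 \<Longrightarrow> br (v # xs) = scale s (br (xs @ [v]))"
proof -
  define \<sigma> where "\<sigma> = (\<lambda>k. if k \<in> {1..<n} then k + 1 else if k = n then 1 else k)"
  have perm: "\<sigma> permutes {1..n}"
    unfolding \<sigma>_def using arity by (intro cyclic_shift_permutes) simp
  have "br (v # xs) = scale (of_int (sign \<sigma>)) (br (xs @ [v]))" if len: "length xs = n - 1" for v xs
  proof -
    define x where "x = (\<lambda>k. (v # xs) ! (k - 1))"
    have "seg x 1 n = v # xs"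
      using seg_of_list[of "v # xs"] len arity by (simp add: x_def)
    moreover have "seg (x \<circ> \<sigma>) 1 n = xs @ [v]"
      by (rule nth_equalityI)
        (use len arity in \<open>auto simp: seg_nth x_def \<sigma>_def nth_append\<close>)
    ultimately show ?thesis
      using antisym[OF perm, of x] by simp
  qed
  then show thesis by (rule that)
qed

section \<open>The identity for right multiplications\<close>

locale multiplicative_hom_nambu_lie_algebra = hom_nambu_lie_algebra +
  fixes a :: "'b \<Rightarrow> 'b"
  assumes twist_eq: "\<And>i. i \<in> {1..n-1} \<Longrightarrow> \<alpha> i = a"
    and twist_br_seg: "\<And>x. a (br (seg x 1 n)) = br (seg (a \<circ> x) 1 n)"
begin

lemma twist_br: "length ys = n \<Longrightarrow> a (br ys) = br (map a ys)"
  using twist_br_seg[of "\<lambda>k. ys ! (k - 1)"] seg_of_list[of ys] map_seg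
  by metis

lemma left_nambu:
  assumes "length xs = n - 1" "length ys = n"
  shows "br (map a xs @ [br ys]) =
    (\<Sum>i<n. br (map a (take i ys) @ [br (xs @ [ys ! i])] @ map a (drop (Suc i) ys)))"
proof -
  define x where "x = (\<lambda>k. xs ! (k - 1))"
  define y where "y = (\<lambda>k. ys ! (k - 1))"
  have x: "seg x 1 (n - 1) = xs" and y: "seg y 1 n = ys"
    using seg_of_list[of xs] seg_of_list[of ys] assms by (simp_all add: x_def y_def)
  have "br (map a xs @ [br ys]) = br (tw \<alpha> 1 (seg x 1 (n-1)) @ [br (seg y 1 n)])"
    using x y by (subst tw_const[where a = a]) (auto intro!: twist_eq)
  also have "\<dots> = (\<Sum>i=1..n. br (tw \<alpha> 1 (seg y 1 (i-1)) @ [br (seg x 1 (n-1) @ [y i])]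
                      @ tw \<alpha> i (seg y (i+1) n)))"
    by (rule hom_nambu)
  also have "\<dots> = (\<Sum>i<n. br (map a (take i ys) @ [br (xs @ [ys ! i])] @ map a (drop (Suc i) ys)))"
  proof (rule sum.reindex_bij_witness[of _ Suc "\<lambda>i. i - 1"])
    fix i assume i: "i \<in> {1..n}"
    have "tw \<alpha> 1 (seg y 1 (i-1)) = map a (take (i - 1) ys)"
      using i seg_take[of "i - 1" n 1 y] y
      by (subst tw_const[where a = a]) (auto intro!: twist_eq)
    moreover have "tw \<alpha> i (seg y (i+1) n) = map a (drop i ys)"
      using i seg_drop[of i y 1 n] y
      by (subst tw_const[where a = a]) (auto intro!: twist_eq)
    ultimately show "br (map a (take (i - 1) ys) @ [br (xs @ [ys ! (i - 1)])]
          @ map a (drop (Suc (i - 1)) ys)) =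
        br (tw \<alpha> 1 (seg y 1 (i-1)) @ [br (seg x 1 (n-1) @ [y i])] @ tw \<alpha> i (seg y (i+1) n))"
      using i x by (simp add: y_def)
  qed auto
  finally show ?thesis .
qed

text \<open>
  The shift is applied to the outer bracket on the left-hand side, and to the inner bracket of each
  summand on the right-hand side, where its sign is moved through the outer bracket by linearity.
\<close>

lemma right_nambu:
  assumes xs: "length xs = n - 1" and ys: "length ys = n"
  shows "br (br ys # map a xs) =
    (\<Sum>i<n. br (map a (take i ys) @ [br (ys ! i # xs)] @ map a (drop (Suc i) ys)))"
proof -
  obtain s where s: "\<And>v xs. length xs = n - 1 \<Longrightarrow> br (v # xs) = scale s (br (xs @ [v]))"
    by (rule br_cyclic_shift) blast
  have "br (br ys # map a xs) = scale s (br (map a xs @ [br ys]))"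
    using xs by (intro s) simp
  also have "\<dots> = (\<Sum>i<n. scale s (br (map a (take i ys) @ [br (xs @ [ys ! i])]
                                        @ map a (drop (Suc i) ys))))"
    using xs ys by (simp add: left_nambu scale_sum_right)
  also have "\<dots> = (\<Sum>i<n. br (map a (take i ys) @ [br (ys ! i # xs)] @ map a (drop (Suc i) ys)))"
  proof (rule sum.cong[OF refl])
    fix i assume "i \<in> {..<n}"
    then have "length (map a (take i ys)) + length (map a (drop (Suc i) ys)) + 1 = n"
      using ys by simp
    then show "scale s (br (map a (take i ys) @ [br (xs @ [ys ! i])] @ map a (drop (Suc i) ys))) =
        br (map a (take i ys) @ [br (ys ! i # xs)] @ map a (drop (Suc i) ys))"
      unfolding s[OF xs] by (rule br_slot_scale[symmetric])
  qed
  finally show ?thesis .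
qed

text \<open>
  The summands of the identity in which \<open>ys\<close> acts on an entry of \<open>xs\<close> rather than on \<open>z\<close>.
  They measure how far the right multiplications by \<open>xs\<close> and \<open>ys\<close> are from commuting, up to twists.
\<close>

definition derivation_defect :: "'b \<Rightarrow> 'b list \<Rightarrow> 'b list \<Rightarrow> 'b"
  where "derivation_defect z xs ys =
    (\<Sum>i<n-1. br (a z # map a (take i xs) @ [br (xs ! i # ys)] @ map a (drop (Suc i) xs)))"

lemma right_nambu_head:
  assumes "length xs = n - 1" "length ys = n - 1"
  shows "br (br (z # xs) # map a ys) = br (br (z # ys) # map a xs) + derivation_defect z xs ys"
proof -
  have n: "n = Suc (n - 1)" using arity by simp
  have "br (br (z # xs) # map a ys) = (\<Sum>i<n. br (map a (take i (z # xs))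
            @ [br ((z # xs) ! i # ys)] @ map a (drop (Suc i) (z # xs))))"
    using assms arity by (intro right_nambu) auto
  also have "\<dots> = br (br (z # ys) # map a xs) + derivation_defect z xs ys"
    by (subst n, subst sum.lessThan_Suc_shift) (simp add: derivation_defect_def)
  finally show ?thesis .
qed

section \<open>Vanishing of the Maltsevian\<close>

text \<open>
  A twist of a bracket with head \<open>w\<close> and tail as in \<open>derivation_defect\<close> is a full summand of it, for
  twisted \<open>xs\<close> and \<open>ys\<close>: the head gets exactly its missing twist, since in the Maltsevian
  \<open>w = [z, x]\<close> occurs bare inside the outer application of \<open>a\<close>.
\<close>

lemma twist_defect_summand:
  assumes "length xs = n - 1" "length ys = n - 1" "i < n - 1"
  shows "a (br (w # map a (take i xs) @ [br (xs ! i # ys)] @ map a (drop (Suc i) xs))) =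
    br (a w # map a (take i (map a xs)) @ [br (map a xs ! i # map a ys)]
      @ map a (drop (Suc i) (map a xs)))"
  using assms arity by (simp add: twist_br take_map drop_map)

lemma br_derivation_defect:
  assumes "length us = n - 1"
  shows "br (derivation_defect z xs ys # us) =
    (\<Sum>i<n-1. br (br (a z # map a (take i xs) @ [br (xs ! i # ys)] @ map a (drop (Suc i) xs)) # us))"
  using br_slot_sum[of "[]" us] assms arity by (simp add: derivation_defect_def)

lemma hom_maltsevian_eq:
  fixes x y :: "nat \<Rightarrow> 'b"
  defines "xs \<equiv> seg x 2 n" and "ys \<equiv> seg y 2 n"
  shows "hom_maltsevian n br \<alpha> z x y =
      derivation_defect (br (z # xs)) (map a xs) (map a ys)
    + br (derivation_defect z xs ys # map a (map a xs))
    - br (br (br (z # xs) # map a xs) # map a (map a ys))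
    + br (br (br (z # ys) # map a xs) # map a (map a xs))"
proof -
  have len: "length xs = n - 1" "length ys = n - 1"
    by (simp_all add: xs_def ys_def)
  then have len_twisted: "length (map a (map a xs)) = n - 1"
    by simp
  have tw_all: "tw \<alpha> 1 xs = map a xs"
    "tw2 \<alpha> 1 xs = map a (map a xs)" "tw2 \<alpha> 1 ys = map a (map a ys)"
    unfolding xs_def ys_def
    by (subst tw_const[where a = a] tw2_const[where a = a]; auto intro!: twist_eq)+
  have \<alpha>1: "\<alpha> 1 = a"
    using arity by (intro twist_eq) simp
  have tw_take: "tw \<alpha> 2 (seg x 2 (i - 1)) = map a (take (i - 2) xs)"
    and tw_drop: "tw \<alpha> i (seg x (i + 1) n) = map a (drop (Suc (i - 2)) xs)"
    and nth: "x i = xs ! (i - 2)" if i: "i \<in> {2..n}" for i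
  proof -
    obtain j where j: "i = Suc (Suc j)" "Suc j < n"
      using i le_Suc_ex[of 2 i] by auto
    show "tw \<alpha> 2 (seg x 2 (i - 1)) = map a (take (i - 2) xs)"
      using j seg_take[of j n 2 x]
      by (subst tw_const[where a = a]) (auto intro!: twist_eq simp: xs_def)
    show "tw \<alpha> i (seg x (i + 1) n) = map a (drop (Suc (i - 2)) xs)"
      using j seg_drop[of "Suc j" x 2 n]
      by (subst tw_const[where a = a]) (auto intro!: twist_eq simp: xs_def)
    show "x i = xs ! (i - 2)"
      using j by (simp add: xs_def seg_nth)
  qed
  have first: "(\<Sum>i=2..n. a (br ([br (z # xs)] @ tw \<alpha> 2 (seg x 2 (i-1))
        @ [br (x i # ys)] @ tw \<alpha> i (seg x (i+1) n)))) =
      derivation_defect (br (z # xs)) (map a xs) (map a ys)"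
    unfolding derivation_defect_def
  proof (rule sum.reindex_bij_witness[of _ "\<lambda>i. i + 2" "\<lambda>i. i - 2"])
    fix i assume i: "i \<in> {2..n}"
    show "br (a (br (z # xs)) # map a (take (i - 2) (map a xs))
          @ [br (map a xs ! (i - 2) # map a ys)] @ map a (drop (Suc (i - 2)) (map a xs))) =
        a (br ([br (z # xs)] @ tw \<alpha> 2 (seg x 2 (i-1)) @ [br (x i # ys)]
          @ tw \<alpha> i (seg x (i+1) n)))"
      unfolding tw_take[OF i] tw_drop[OF i] nth[OF i] using i
      by (subst twist_defect_summand[OF len, symmetric]) auto
  qed auto
  have second: "(\<Sum>i=2..n. br ([br ([a z] @ tw \<alpha> 2 (seg x 2 (i-1))
        @ [br (x i # ys)] @ tw \<alpha> i (seg x (i+1) n))] @ map a (map a xs))) =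
      br (derivation_defect z xs ys # map a (map a xs))"
    unfolding br_derivation_defect[OF len_twisted]
  proof (rule sum.reindex_bij_witness[of _ "\<lambda>i. i + 2" "\<lambda>i. i - 2"])
    fix i assume i: "i \<in> {2..n}"
    show "br (br (a z # map a (take (i - 2) xs) @ [br (xs ! (i - 2) # ys)]
          @ map a (drop (Suc (i - 2)) xs)) # map a (map a xs)) =
        br ([br ([a z] @ tw \<alpha> 2 (seg x 2 (i-1)) @ [br (x i # ys)]
          @ tw \<alpha> i (seg x (i+1) n))] @ map a (map a xs))"
      unfolding tw_take[OF i] tw_drop[OF i] nth[OF i] by simp
  qed auto
  show ?thesis
    unfolding hom_maltsevian_def xs_def[symmetric] ys_def[symmetric] \<alpha>1 tw_all first second
    by simp
qed

text \<open>
  The identity is used for \<open>(z, x, y)\<close> inside a right multiplication by \<open>a\<^sup>2 x\<close>, and for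
  \<open>([z, x], a x, a y)\<close>; both produce \<open>[[[z, x], a y], a\<^sup>2 x]\<close>, which does not occur in the Maltsevian
  and drops out.
\<close>

lemma hom_maltsevian_zero: "hom_maltsevian n br \<alpha> z x y = 0"
proof -
  define xs where "xs = seg x 2 n"
  define ys where "ys = seg y 2 n"
  have len: "length xs = n - 1" "length ys = n - 1"
    by (simp_all add: xs_def ys_def)
  have "br (br (br (z # xs) # map a ys) # map a (map a xs)) =
      br (br (br (z # ys) # map a xs) # map a (map a xs))
    + br (derivation_defect z xs ys # map a (map a xs))"
    unfolding right_nambu_head[OF len]
    using br_slot_add[of "[]" "map a (map a xs)"] len arity by simp
  moreover have "br (br (br (z # xs) # map a xs) # map a (map a ys)) =
      br (br (br (z # xs) # map a ys) # map a (map a xs))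
    + derivation_defect (br (z # xs)) (map a xs) (map a ys)"
    using len by (intro right_nambu_head) simp_all
  ultimately show ?thesis
    by (simp add: hom_maltsevian_eq flip: xs_def ys_def)
qed

end

theorem theorem6p2:
  fixes scale :: "'k::field_char_0 \<Rightarrow> 'a::ab_group_add \<Rightarrow> 'a"
    and n :: nat
    and br :: "'a list \<Rightarrow> 'a"
    and \<alpha> :: "nat \<Rightarrow> 'a \<Rightarrow> 'a"
  assumes "n \<ge> 2"
    and "hom_nambu_lie_algebra scale n br \<alpha>"
    and "multiplicative n br \<alpha>"
  shows "hom_maltsev_algebra scale n br \<alpha> \<and> multiplicative n br \<alpha>"
proof
  obtain a where a: "\<And>i. i \<in> {1..n-1} \<Longrightarrow> \<alpha> i = a"
      "\<And>x. a (br (seg x 1 n)) = br (seg (a \<circ> x) 1 n)"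
    using assms(3) unfolding multiplicative_def by blast
  interpret hom_nambu_lie_algebra scale n br \<alpha> by fact
  interpret multiplicative_hom_nambu_lie_algebra scale n br \<alpha> a
    by unfold_locales (fact a)+
  show "hom_maltsev_algebra scale n br \<alpha>"
    by unfold_locales (rule hom_maltsevian_zero)
qed fact

end
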